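(* Let $f$, $K$, $u$, $\bar q$, $\underline L$, the noises $(\zeta_n),(\chi_n)$, the number $\delta\in(0,u)$, and the parameters $a,\varepsilon_0,k,J^{(j)},\ell_c,B,\rho,\mu,\ell,\alpha_j$ be as in the context. Let $z_n$ be a solution of $$z_{n+1}=f(z_n)-\alpha_j(1+\ell_c\chi_{n+1})\frac{f(z_n)-K}{|f(z_n)-K|}+\ell\zeta_{n+1},\qquad z_n\in J^{(j)}\setminus J^{(j+1)},\ j=0,\dots,k-1,$$ with initial value $z_0\in(K-u,K+u)$. Then there exists a random moment $\tau$ such that, for any $\omega\in\Omega$, $$z_\tau(\omega)\in(K-\delta,K+\delta)\quad\text{and}\quad \tau(\omega)\le\frac{\ln(\delta/u)}{\ln(1-\mu)} .$$
   Context: $(\Omega,\mathcal F,(\mathcal F_n)_{n\in\mathbb N},\mathbb P)$ is a complete filtered probability space. Each of the sequences $(\zeta_n)_{n\in\mathbb N}$, $(\chi_n)_{n\in\mathbb N}$ consists of identically distributed random variables; all the $\zeta_n,\chi_n$ are mutually independent, and $|\zeta_n|\le1$, $|\chi_n|\le1$. The function $f:[0,\infty)\to[0,\infty)$ is continuous with a unique positive fixed point $K>0$, and there are $\bar q>0$, $\underline L>0$, $u>0$ such that $\bar q<\underline L$ and $$\underline L|z-K|\le|f(z)-K|\le(1+\bar q)|z-K|\quad\text{for } z\in(K-u,K+u).$$ Parameters (with $[t]$ the integer part of $t$): $a\in(1,\underline L/\bar q)$ and $\varepsilon_0:=\underline L-\bar q a$; $k_{\delta,u}:=\min\{j\in\mathbb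 N: ua^{-(j+1)}<\delta\}=[\log_a(u/\delta)]$ and $k:=k_{\delta,u}+1$; $J^{(0)}:=(K-u,K+u)$, $J^{(j)}:=(K-a^{-j}u,K+a^{-j}u)$ for $j=1,\dots,k_{\delta,u}$, and $J^{(k)}:=(K-\delta,K+\delta)$; $$\ell_c\in\left(0,\frac{\varepsilon_0}{2\bar qa+\varepsilon_0}\right),\qquad B\in\left(\frac{\bar qa^2}{\underline L(1-\ell_c)},\frac{a}{1+\ell_c}\right);$$ $$\rho:=1+\bar q-\frac{\underline L(1-\ell_c)B}{a^2},\qquad \mu\in(0,1-\rho),\qquad 0<\ell\le(1-\rho-\mu)\delta;$$ $$\alpha_j:=\underline L\,a^{-(j+2)}uB,\qquad j=0,1,\dots,k .$$ The equation in the claim (Directed Walk Control) is applied until the solution enters $J^{(k)}=(K-\delta,K+\delta)$.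
   Formalization: The bound on τ is rounded up to the next integer, τ ≤ ⌈ln(δ/u)/ln(1−μ)⌉, since the printed bound fails for integer τ: when the quotient is below 1 it forces τ = 0 although z_0 may lie outside (K−δ, K+δ). *)

theory Defs
  imports "HOL-Probability.Probability"
begin

text \<open>Only the underlying probability space is required to be complete; the
  \<open>\<sigma>\<close>-algebras \<open>F n\<close> need not contain the null sets, so the natural filtration of
  the noises is admitted.\<close>

locale complete_filtered_prob_space =
  prob_space M + complete_measure M + filtration "space M" F
  for M :: "'a measure" and F :: "nat \<Rightarrow> 'a measure" +
  assumes sub: "\<And>n. subalgebra M (F n)"

definition k_du :: "real \<Rightarrow> real \<Rightarrow> real \<Rightarrow> nat" where
  "k_du u a \<delta> = (LEAST j::nat. u / a ^ (j + 1) < \<delta>)"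

definition k_last :: "real \<Rightarrow> real \<Rightarrow> real \<Rightarrow> nat" where
  "k_last u a \<delta> = k_du u a \<delta> + 1"

text \<open>For \<open>j = 0\<close> the first branch is \<open>(K - u, K + u)\<close>; the second branch is meant for
  \<open>j = k_last u a \<delta>\<close> only.\<close>

definition J :: "real \<Rightarrow> real \<Rightarrow> real \<Rightarrow> real \<Rightarrow> nat \<Rightarrow> real set" where
  "J K u a \<delta> j =
     (if j \<le> k_du u a \<delta> then {K - u / a ^ j <..< K + u / a ^ j} else {K - \<delta> <..< K + \<delta>})"

definition \<alpha> :: "real \<Rightarrow> real \<Rightarrow> real \<Rightarrow> real \<Rightarrow> nat \<Rightarrow> real" where
  "\<alpha> L u a B j = L * (u / a ^ (j + 2)) * B"

text \<open>The equation is imposed only as long as the solution has not entered the target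
  interval \<open>J K u a \<delta> (k_last u a \<delta>)\<close>; later values of \<open>z\<close> are unconstrained.\<close>

definition dwc_solution ::
  "'a measure \<Rightarrow> (real \<Rightarrow> real) \<Rightarrow> real \<Rightarrow> real \<Rightarrow> real \<Rightarrow> real \<Rightarrow> real \<Rightarrow> real \<Rightarrow> real \<Rightarrow> real
    \<Rightarrow> (nat \<Rightarrow> 'a \<Rightarrow> real) \<Rightarrow> (nat \<Rightarrow> 'a \<Rightarrow> real) \<Rightarrow> (nat \<Rightarrow> 'a \<Rightarrow> real) \<Rightarrow> bool" where
  "dwc_solution M f K u L a \<delta> B l\<^sub>c l zeta chi z \<longleftrightarrow>
     (\<forall>\<omega>\<in>space M. \<forall>n. \<forall>j<k_last u a \<delta>. z n \<omega> \<in> J K u a \<delta> j - J K u a \<delta> (j + 1) \<longrightarrow>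
        z (n + 1) \<omega> =
          f (z n \<omega>)
          - \<alpha> L u a B j * (1 + l\<^sub>c * chi (n + 1) \<omega>) * ((f (z n \<omega>) - K) / \<bar>f (z n \<omega>) - K\<bar>)
          + l * zeta (n + 1) \<omega>)"

end

theory Submission
  imports Defs
begin

text \<open>While the solution is in the \<open>j\<close>-th shell, its distance \<open>r\<close> to \<open>K\<close> satisfies
  \<open>u / a ^ (j + 1) \<le> r < u / a ^ j\<close>. The lower bound keeps the control from overshooting \<open>K\<close>;
  the upper bound makes the control at least \<open>L (1 - l\<^sub>c) B r / a\<^sup>2\<close>. Hence one step leaves a distance of
  at most \<open>\<rho> r + l\<close>, and \<open>l \<le> (1 - \<rho> - \<mu>) r\<close> outside the target, so the distance shrinks
  by the factor \<open>1 - \<mu>\<close> at every step before entry.\<close>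

text \<open>The process need not be measurable after the entry, so the entry time is compared with that of the
  process frozen at its entry.\<close>

lemma measurable_entry_time:
  fixes z :: "nat \<Rightarrow> 'a \<Rightarrow> real" and G :: "nat \<Rightarrow> real \<Rightarrow> 'a \<Rightarrow> real"
  assumes S [measurable]: "S \<in> sets borel"
    and z0: "z 0 \<in> borel_measurable M"
    and G: "\<And>n. case_prod (G n) \<in> borel_measurable (borel \<Otimes>\<^sub>M M)"
    and step: "\<And>n \<omega>. \<omega> \<in> space M \<Longrightarrow> \<forall>m\<le>n. z m \<omega> \<notin> S \<Longrightarrow> z (Suc n) \<omega> = G n (z n \<omega>) \<omega>"
    and enters: "\<And>\<omega>. \<omega> \<in> space M \<Longrightarrow> \<exists>n. z n \<omega> \<in> S"
  shows "(\<lambda>\<omega>. LEAST n. z n \<omega> \<in> S) \<in> M \<rightarrow>\<^sub>M count_space UNIV"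
proof -
  define y where
    "y = rec_nat (z 0) (\<lambda>n v \<omega>. if v \<omega> \<in> S then v \<omega> else G n (v \<omega>) \<omega>)"
  have y0: "y 0 = z 0"
    and ySuc: "y (Suc n) = (\<lambda>\<omega>. if y n \<omega> \<in> S then y n \<omega> else G n (y n \<omega>) \<omega>)" for n
    unfolding y_def by simp_all
  have y_meas [measurable]: "y n \<in> borel_measurable M" for n
  proof (induction n)
    case 0
    show ?case using z0 by (simp add: y0)
  next
    case (Suc n)
    note [measurable] = Suc
    \<comment> \<open>State and noise depend on the same \<omega>, so the joint measurability of
      \<open>G n\<close> is composed with the map from \<omega> to
      \<open>(y n \<omega>, \<omega>)\<close>.\<close>
    have "(\<lambda>\<omega>. case_prod (G n) (y n \<omega>, \<omega>)) \<in> borel_measurable M"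
      by (rule measurable_compose[OF _ G]) measurable
    hence [measurable]: "(\<lambda>\<omega>. G n (y n \<omega>) \<omega>) \<in> borel_measurable M" by simp
    show ?case unfolding ySuc by measurable
  qed
  \<comment> \<open>Only the times strictly before \<open>n\<close> have to lie outside
    \<open>S\<close>, so \<open>y\<close> and \<open>z\<close> agree at the entry time as well;
    hence their entry times coincide.\<close>
  have y_eq: "y n \<omega> = z n \<omega>" if "\<omega> \<in> space M" "\<forall>m<n. z m \<omega> \<notin> S" for n \<omega>
    using that(2)
  proof (induction n)
    case 0
    show ?case by (simp add: y0)
  next
    case (Suc n)
    have "y n \<omega> = z n \<omega>" "\<forall>m\<le>n. z m \<omega> \<notin> S"
      using Suc by auto
    then show ?case using step[OF that(1), of n] by (simp add: ySuc)
  qed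
  have "(LEAST n. z n \<omega> \<in> S) = (LEAST n. y n \<omega> \<in> S)" if \<omega>: "\<omega> \<in> space M" for \<omega>
  proof -
    let ?t = "LEAST n. z n \<omega> \<in> S"
    have t: "z ?t \<omega> \<in> S" using enters[OF \<omega>] by (rule LeastI_ex)
    have before: "z m \<omega> \<notin> S" if "m < ?t" for m using that by (rule not_less_Least)
    have eq: "y m \<omega> = z m \<omega>" if "m \<le> ?t" for m
      by (rule y_eq[OF \<omega>]) (meson before that less_le_trans)
    have "(LEAST n. y n \<omega> \<in> S) = ?t"
    proof (rule Least_equality)
      show "y ?t \<omega> \<in> S" using t by (simp only: eq[OF order_refl])
      show "?t \<le> m" if m: "y m \<omega> \<in> S" for m
      proof (rule ccontr)
        assume "\<not> ?t \<le> m"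
        then have "m < ?t" by (rule not_le_imp_less)
        with m before[OF this] eq[OF less_imp_le[OF this]] show False by metis
      qed
    qed
    then show ?thesis by simp
  qed
  moreover have "(\<lambda>\<omega>. LEAST n. y n \<omega> \<in> S) \<in> M \<rightarrow>\<^sub>M count_space UNIV"
    by measurable
  ultimately show ?thesis
    by (simp cong: measurable_cong)
qed

text \<open>Here \<open>R\<close> is the outer radius of a shell, \<open>y\<close> the value of
  \<open>f\<close> at \<open>x\<close>, and \<open>c\<close>, \<open>s\<close> are noise values. As
  the control \<open>C\<close> never exceeds \<open>\<bar>y - K\<bar>\<close>, subtracting it in the
  direction of \<open>y - K\<close> reduces the distance to \<open>K\<close> by exactly
  \<open>C\<close>.\<close>

lemma dwc_step_contraction:
  fixes K L q a B R l\<^sub>c l \<mu> \<delta> x y c s :: real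
  assumes y: "L * \<bar>x - K\<bar> \<le> \<bar>y - K\<bar>" "\<bar>y - K\<bar> \<le> (1 + q) * \<bar>x - K\<bar>"
    and x: "R / a \<le> \<bar>x - K\<bar>" "\<bar>x - K\<bar> \<le> R" "\<delta> \<le> \<bar>x - K\<bar>"
    and pos: "0 < L" "0 < R" "1 < a" "0 < B"
    and l\<^sub>c: "0 < l\<^sub>c" "l\<^sub>c < 1" and B: "B * (1 + l\<^sub>c) \<le> a"
    and noise: "\<bar>c\<bar> \<le> 1" "\<bar>s\<bar> \<le> 1"
    and \<rho>: "\<rho> = 1 + q - L * (1 - l\<^sub>c) * B / a\<^sup>2"
    and \<mu>: "\<mu> \<le> 1 - \<rho>"
    and l: "0 \<le> l" "l \<le> (1 - \<rho> - \<mu>) * \<delta>"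
  shows "\<bar>y - L * (R / a\<^sup>2) * B * (1 + l\<^sub>c * c) * ((y - K) / \<bar>y - K\<bar>) + l * s - K\<bar>
    \<le> (1 - \<mu>) * \<bar>x - K\<bar>"
proof -
  define A where "A = L * (R / a\<^sup>2) * B"
  define C where "C = A * (1 + l\<^sub>c * c)"
  have A0: "0 < A" using pos by (simp add: A_def)
  have "\<bar>l\<^sub>c * c\<bar> \<le> l\<^sub>c" using l\<^sub>c noise by (simp add: abs_mult mult_left_le)
  hence "- l\<^sub>c \<le> l\<^sub>c * c" "l\<^sub>c * c \<le> l\<^sub>c" by linarith+
  hence C: "A * (1 - l\<^sub>c) \<le> C" "C \<le> A * (1 + l\<^sub>c)"
    using A0 by (auto simp: C_def intro!: mult_left_mono)
  \<comment> \<open>The upper bound on \<open>B\<close> enters here: even the largest control is at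
    most \<open>L * (R / a)\<close>, where \<open>R / a\<close> bounds
    \<open>\<bar>x - K\<bar>\<close> from below.\<close>
  have "A * (1 + l\<^sub>c) = L * (R / a\<^sup>2) * (B * (1 + l\<^sub>c))" by (simp add: A_def)
  also have "\<dots> \<le> L * (R / a\<^sup>2) * a" using B pos by (intro mult_left_mono) auto
  also have "\<dots> = L * (R / a)" using pos by (simp add: power2_eq_square)
  also have "\<dots> \<le> L * \<bar>x - K\<bar>" using x pos by (intro mult_left_mono) auto
  finally have no_overshoot: "C \<le> \<bar>y - K\<bar>" using C y by linarith
  \<comment> \<open>The quotient \<open>(y - K) / \<bar>y - K\<bar>\<close> is a sign only away from
    \<open>K\<close>; at \<open>y = K\<close> division by zero would make it 0.\<close>
  have "L * \<bar>x - K\<bar> > 0"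
  proof -
    have "0 < R / a" using pos by simp
    with x(1) pos(1) show ?thesis by simp
  qed
  hence "y \<noteq> K" using y by auto
  then consider "y > K" "(y - K) / \<bar>y - K\<bar> = 1" | "y < K" "(y - K) / \<bar>y - K\<bar> = - 1"
    by (cases "y > K") (auto simp: divide_eq_eq)
  hence "\<bar>y - C * ((y - K) / \<bar>y - K\<bar>) - K\<bar> = \<bar>\<bar>y - K\<bar> - C\<bar>"
  proof cases
    case 1
    show ?thesis unfolding 1(2) using 1(1) by simp
  next
    case 2
    show ?thesis unfolding 2(2) using 2(1) by simp
  qed
  also have "\<dots> = \<bar>y - K\<bar> - C" using no_overshoot by simp
  finally have "\<bar>y - C * ((y - K) / \<bar>y - K\<bar>) - K\<bar> = \<bar>y - K\<bar> - C" .
  moreover have "\<bar>l * s\<bar> \<le> l" using l noise by (simp add: abs_mult mult_left_le)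
  ultimately have "\<bar>y - C * ((y - K) / \<bar>y - K\<bar>) + l * s - K\<bar> \<le> \<bar>y - K\<bar> - C + l"
    by linarith
  also have "\<dots> \<le> (1 + q) * \<bar>x - K\<bar> - A * (1 - l\<^sub>c) + (1 - \<rho> - \<mu>) * \<bar>x - K\<bar>"
  proof -
    \<comment> \<open>The noise amplitude is tied to \<open>\<delta>\<close>; outside the target it
      can be charged to \<open>\<bar>x - K\<bar>\<close>, since the factor
      \<open>1 - \<rho> - \<mu>\<close> is nonnegative.\<close>
    have "(1 - \<rho> - \<mu>) * \<delta> \<le> (1 - \<rho> - \<mu>) * \<bar>x - K\<bar>"
      using \<mu> x by (intro mult_left_mono) auto
    then show ?thesis using C y l by linarith
  qed
  also have "\<dots> \<le> (1 - \<mu>) * \<bar>x - K\<bar>"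
  proof -
    \<comment> \<open>The least control \<open>A * (1 - l\<^sub>c)\<close> is constant on a shell;
      \<open>\<bar>x - K\<bar> \<le> R\<close> bounds it below by a multiple of the distance. The
      coefficients then add up to \<open>\<rho> + (1 - \<rho> - \<mu>)\<close>, which is
      \<open>1 - \<mu>\<close>.\<close>
    have "(L * (1 - l\<^sub>c) * B / a\<^sup>2) * \<bar>x - K\<bar> \<le> (L * (1 - l\<^sub>c) * B / a\<^sup>2) * R"
      using pos l\<^sub>c x by (intro mult_left_mono) auto
    also have "\<dots> = A * (1 - l\<^sub>c)" by (simp add: A_def)
    finally show ?thesis unfolding \<rho> by (simp add: algebra_simps)
  qed
  finally show ?thesis by (simp add: A_def C_def)
qed

text \<open>The powers of \<open>a\<close> are unbounded, so the predicate under
  \<open>LEAST\<close> has a witness.\<close>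

lemma k_du_less:
  assumes "0 < \<delta>" "1 < a"
  shows "u / a ^ (k_du u a \<delta> + 1) < \<delta>"
proof -
  obtain n where "u / \<delta> < a ^ n" using real_arch_pow[OF assms(2)] by blast
  also have "a ^ n \<le> a ^ (n + 1)" using assms by (intro power_increasing) auto
  finally have "u / a ^ (n + 1) < \<delta>" using assms by (simp add: field_simps)
  then show ?thesis unfolding k_du_def by (rule LeastI)
qed

text \<open>The target is the last interval, so a point outside it misses some interval, and the
  first one missed determines the shell. The \<open>LEAST\<close> formula makes the shell index an
  explicit function of \<open>x\<close>, as the measurability argument requires.\<close>

lemma first_exit_shell:
  assumes x: "x \<in> {K - u <..< K + u}" "x \<notin> {K - \<delta> <..< K + \<delta>}"
    and \<delta>: "0 < \<delta>" and a: "1 < a"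
    and j: "j = (LEAST j. x \<notin> J K u a \<delta> (j + 1))"
  shows "j < k_last u a \<delta>" "x \<in> J K u a \<delta> j - J K u a \<delta> (j + 1)"
    "u / a ^ (j + 1) \<le> \<bar>x - K\<bar>" "\<bar>x - K\<bar> < u / a ^ j"
proof -
  have k: "x \<notin> J K u a \<delta> (k_du u a \<delta> + 1)" using x by (simp add: J_def)
  have j1: "x \<notin> J K u a \<delta> (j + 1)" unfolding j by (rule LeastI, rule k)
  have le: "j \<le> k_du u a \<delta>" unfolding j by (rule Least_le, rule k)
  then show "j < k_last u a \<delta>" by (simp add: k_last_def)
  have j0: "x \<in> J K u a \<delta> j"
  proof (cases j)
    case 0
    then show ?thesis using x by (simp add: J_def)
  next
    case (Suc i)
    then have "i < (LEAST j. x \<notin> J K u a \<delta> (j + 1))" using j by simp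
    then show ?thesis using not_less_Least Suc by fastforce
  qed
  with j1 show "x \<in> J K u a \<delta> j - J K u a \<delta> (j + 1)" by simp
  show "\<bar>x - K\<bar> < u / a ^ j" using j0 le by (auto simp: J_def abs_less_iff)
  show "u / a ^ (j + 1) \<le> \<bar>x - K\<bar>"
  proof (cases "j + 1 \<le> k_du u a \<delta>")
    case True
    then show ?thesis using j1 by (auto simp: J_def not_less)
  next
    \<comment> \<open>The innermost shell ends at radius \<open>\<delta>\<close>, not at
      \<open>u / a ^ (j + 1)\<close>; the choice of \<open>k_du\<close> makes the latter
      smaller.\<close>
    case False
    then have "j = k_du u a \<delta>" using le by simp
    then have "u / a ^ (j + 1) < \<delta>" using k_du_less[OF \<delta> a] by simp
    then show ?thesis using x(2) by auto
  qed
qed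

text \<open>Continuity of \<open>f\<close> is given on the half-line, so composing with
  \<open>max 0 x\<close> yields a continuous function on the whole line. The shell index takes
  values in a discrete space, so every function of it is measurable.\<close>

lemma measurable_dwc_step:
  fixes f :: "real \<Rightarrow> real"
  assumes f: "continuous_on {0..} f"
    and [measurable]: "chi \<in> borel_measurable M" "zeta \<in> borel_measurable M"
  shows "(\<lambda>(x, \<omega>). f (max 0 x)
      - \<alpha> L u a B (LEAST j. x \<notin> J K u a \<delta> (j + 1)) * (1 + l\<^sub>c * chi \<omega>)
        * ((f (max 0 x) - K) / \<bar>f (max 0 x) - K\<bar>) + l * zeta \<omega>)
    \<in> borel_measurable (borel \<Otimes>\<^sub>M M)"
proof -
  have [measurable]: "(\<lambda>x. f (max 0 x)) \<in> borel_measurable borel"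
    by (intro borel_measurable_continuous_onI continuous_on_compose2[OF f] continuous_intros) auto
  have [measurable]: "J K u a \<delta> j \<in> sets borel" for j
    by (simp add: J_def)
  have "(\<lambda>x. LEAST j. x \<notin> J K u a \<delta> (j + 1)) \<in> borel \<rightarrow>\<^sub>M count_space UNIV"
    by measurable
  then have [measurable]: "(\<lambda>x. \<alpha> L u a B (LEAST j. x \<notin> J K u a \<delta> (j + 1))) \<in> borel_measurable borel"
    by (rule measurable_compose) simp
  show ?thesis by measurable
qed

theorem theorem8p3:
  fixes M :: "'a measure" and F :: "nat \<Rightarrow> 'a measure"
    and zeta chi z :: "nat \<Rightarrow> 'a \<Rightarrow> real"
    and f :: "real \<Rightarrow> real"
    and K q L u \<delta> a \<epsilon>\<^sub>0 l\<^sub>c B \<rho> \<mu> l :: real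
  assumes space: "complete_filtered_prob_space M F"
    and indep: "prob_space.indep_vars M (\<lambda>_. borel) (case_sum zeta chi) UNIV"
    and ident_zeta: "\<And>m n. distr M borel (zeta m) = distr M borel (zeta n)"
    and ident_chi: "\<And>m n. distr M borel (chi m) = distr M borel (chi n)"
    and bound_zeta: "\<And>n \<omega>. \<omega> \<in> space M \<Longrightarrow> \<bar>zeta n \<omega>\<bar> \<le> 1"
    and bound_chi: "\<And>n \<omega>. \<omega> \<in> space M \<Longrightarrow> \<bar>chi n \<omega>\<bar> \<le> 1"
    and f_cont: "continuous_on {0..} f"
    and f_nonneg: "f \<in> {0..} \<rightarrow> {0..}"
    and K: "K > 0" "f K = K"
    and K_unique: "\<And>x. x > 0 \<Longrightarrow> f x = x \<Longrightarrow> x = K"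
    and q_L_u: "q > 0" "L > 0" "u > 0" "q < L"
    and domain: "{K - u <..< K + u} \<subseteq> {0..}"
    and f_bounds: "\<And>x. x \<in> {K - u <..< K + u} \<Longrightarrow>
          L * \<bar>x - K\<bar> \<le> \<bar>f x - K\<bar> \<and> \<bar>f x - K\<bar> \<le> (1 + q) * \<bar>x - K\<bar>"
    and \<delta>: "\<delta> \<in> {0 <..< u}"
    and a: "a \<in> {1 <..< L / q}"
    and \<epsilon>\<^sub>0: "\<epsilon>\<^sub>0 = L - q * a"
    and l\<^sub>c: "l\<^sub>c \<in> {0 <..< \<epsilon>\<^sub>0 / (2 * q * a + \<epsilon>\<^sub>0)}"
    and B: "B \<in> {q * a\<^sup>2 / (L * (1 - l\<^sub>c)) <..< a / (1 + l\<^sub>c)}"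
    and \<rho>: "\<rho> = 1 + q - L * (1 - l\<^sub>c) * B / a\<^sup>2"
    and \<mu>: "\<mu> \<in> {0 <..< 1 - \<rho>}"
    and l: "0 < l" "l \<le> (1 - \<rho> - \<mu>) * \<delta>"
    and z0: "z 0 \<in> borel_measurable M" "\<And>\<omega>. \<omega> \<in> space M \<Longrightarrow> z 0 \<omega> \<in> {K - u <..< K + u}"
    and sol: "dwc_solution M f K u L a \<delta> B l\<^sub>c l zeta chi z"
  shows "\<exists>\<tau> \<in> M \<rightarrow>\<^sub>M (count_space (UNIV :: nat set)). \<forall>\<omega>\<in>space M.
           z (\<tau> \<omega>) \<omega> \<in> {K - \<delta> <..< K + \<delta>} \<and>
           int (\<tau> \<omega>) \<le> \<lceil>ln (\<delta> / u) / ln (1 - \<mu>)\<rceil>"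
proof -
  interpret complete_filtered_prob_space M F by (rule space)
  have "case_sum zeta chi i \<in> borel_measurable M" for i
    using indep by (auto simp: indep_vars_def)
  from this[of "Inl n" for n] this[of "Inr n" for n]
  have noise_meas: "zeta n \<in> borel_measurable M" "chi n \<in> borel_measurable M" for n
    by auto
  have a1: "1 < a" and qa: "q * a < L" using a q_L_u by (auto simp: field_simps)
  have \<epsilon>0: "0 < \<epsilon>\<^sub>0" and qa0: "0 < q * a" using qa \<epsilon>\<^sub>0 q_L_u a1 by auto
  have "\<epsilon>\<^sub>0 / (2 * q * a + \<epsilon>\<^sub>0) < 1" using \<epsilon>0 qa0 by (simp add: field_simps)
  then have lc: "0 < l\<^sub>c" "l\<^sub>c < 1" using l\<^sub>c by auto
  have "0 \<le> q * a\<^sup>2 / (L * (1 - l\<^sub>c))" using q_L_u lc by simp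
  then have B0: "0 < B" using B by auto
  have Ba: "B * (1 + l\<^sub>c) < a" using B lc by (simp add: field_simps)
  have \<delta>0: "0 < \<delta>" "\<delta> < u" using \<delta> by auto
  \<comment> \<open>Both bounds on \<open>f\<close> are compared at one point of the interval other
    than \<open>K\<close>.\<close>
  have L_le: "L \<le> 1 + q"
  proof -
    have "L * \<bar>(K + u / 2) - K\<bar> \<le> (1 + q) * \<bar>(K + u / 2) - K\<bar>"
      by (rule order_trans[OF conjunct1[OF f_bounds] conjunct2[OF f_bounds]]) (use q_L_u in auto)
    then show ?thesis using q_L_u by simp
  qed
  \<comment> \<open>Since \<open>(1 - l\<^sub>c) * B\<close> is at most \<open>a\<^sup>2\<close> and
    \<open>L \<le> 1 + q\<close>, \<rho> is nonnegative, so \<open>\<mu> < 1 - \<rho>\<close> gives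
    \<open>\<mu> < 1\<close>.\<close>
  have \<mu>1: "0 < \<mu>" "\<mu> < 1"
  proof -
    have "(1 - l\<^sub>c) * B \<le> B * (1 + l\<^sub>c)" using B0 lc by (simp add: algebra_simps)
    also have "\<dots> \<le> a * a" using Ba a1 by (smt (verit) mult_less_cancel_right2)
    finally have "(1 - l\<^sub>c) * B / a\<^sup>2 \<le> 1" using a1 by (simp add: power2_eq_square)
    then have "L * ((1 - l\<^sub>c) * B / a\<^sup>2) \<le> L" using q_L_u by (intro mult_left_le) auto
    then have "0 \<le> \<rho>" using L_le by (simp add: \<rho>)
    then show "0 < \<mu>" "\<mu> < 1" using \<mu> by auto
  qed
  let ?S = "{K - \<delta> <..< K + \<delta>}"
  let ?j = "\<lambda>x. LEAST j. x \<notin> J K u a \<delta> (j + 1)"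
  \<comment> \<open>The equations for the single shells become one total map; on
    \<open>{K - u <..< K + u}\<close>, which lies in the half-line, \<open>max 0 x\<close> is just
    \<open>x\<close>.\<close>
  let ?G = "\<lambda>n x \<omega>. f (max 0 x) - \<alpha> L u a B (?j x) * (1 + l\<^sub>c * chi (n + 1) \<omega>)
        * ((f (max 0 x) - K) / \<bar>f (max 0 x) - K\<bar>) + l * zeta (n + 1) \<omega>"
  have step: "z (Suc n) \<omega> = ?G n (z n \<omega>) \<omega> \<and> \<bar>z (Suc n) \<omega> - K\<bar> \<le> (1 - \<mu>) * \<bar>z n \<omega> - K\<bar>"
    if \<omega>: "\<omega> \<in> space M" and x: "z n \<omega> \<in> {K - u <..< K + u}" "z n \<omega> \<notin> ?S" for n \<omega>
  proof -
    let ?x = "z n \<omega>"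
    define j where "j = ?j ?x"
    note shell = first_exit_shell[OF x \<delta>0(1) a1 j_def]
    have "max 0 ?x = ?x" using domain x(1) by auto
    moreover have z: "z (Suc n) \<omega> = f ?x - \<alpha> L u a B j * (1 + l\<^sub>c * chi (n + 1) \<omega>)
        * ((f ?x - K) / \<bar>f ?x - K\<bar>) + l * zeta (n + 1) \<omega>"
      using sol[unfolded dwc_solution_def, rule_format, OF \<omega> shell(1,2)] by simp
    moreover have "\<alpha> L u a B j = L * ((u / a ^ j) / a\<^sup>2) * B"
      by (simp add: \<alpha>_def power_add power2_eq_square)
    moreover have "\<bar>f ?x - L * ((u / a ^ j) / a\<^sup>2) * B * (1 + l\<^sub>c * chi (n + 1) \<omega>)
        * ((f ?x - K) / \<bar>f ?x - K\<bar>) + l * zeta (n + 1) \<omega> - K\<bar> \<le> (1 - \<mu>) * \<bar>?x - K\<bar>"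
    proof (rule dwc_step_contraction)
      show "u / a ^ j / a \<le> \<bar>?x - K\<bar>" using shell(3) by (simp add: mult.commute)
      show "\<delta> \<le> \<bar>?x - K\<bar>" using x(2) by auto
    qed (use f_bounds[OF x(1)] shell(4) q_L_u a1 B0 lc Ba bound_chi[OF \<omega>] bound_zeta[OF \<omega>] \<rho> \<mu> l
      in auto)
    ultimately show ?thesis by (simp add: j_def)
  qed
  \<comment> \<open>The bound keeps the process in \<open>{K - u <..< K + u}\<close>, so the
    one-step estimate can be repeated. It is strict because the initial interval is open, and it
    covers the entry time too.\<close>
  have decay: "\<bar>z n \<omega> - K\<bar> < (1 - \<mu>) ^ n * u"
    if \<omega>: "\<omega> \<in> space M" and n: "\<forall>m<n. z m \<omega> \<notin> ?S" for n \<omega>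
    using n
  proof (induction n)
    case 0
    show ?case using z0(2)[OF \<omega>] by (auto simp: abs_less_iff)
  next
    case (Suc n)
    then have IH: "\<bar>z n \<omega> - K\<bar> < (1 - \<mu>) ^ n * u" and out: "z n \<omega> \<notin> ?S" by auto
    have "(1 - \<mu>) ^ n * u \<le> u"
      using \<mu>1 q_L_u by (simp add: mult_left_le_one_le power_le_one)
    with IH have "z n \<omega> \<in> {K - u <..< K + u}" by (auto simp: abs_less_iff)
    then have "\<bar>z (Suc n) \<omega> - K\<bar> \<le> (1 - \<mu>) * \<bar>z n \<omega> - K\<bar>"
      using out by (rule step[OF \<omega>, THEN conjunct2])
    also have "\<dots> < (1 - \<mu>) * ((1 - \<mu>) ^ n * u)" using IH \<mu>1 by simp
    finally show ?case by (simp add: mult.assoc)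
  qed
  \<comment> \<open>\<open>N\<close> is the least number of steps with
    \<open>(1 - \<mu>) ^ N * u \<le> \<delta>\<close>. The quotient is positive, so
    \<open>nat\<close> preserves the ceiling.\<close>
  define N where "N = nat \<lceil>ln (\<delta> / u) / ln (1 - \<mu>)\<rceil>"
  have ln_neg: "ln (1 - \<mu>) < 0" "ln (\<delta> / u) < 0" using \<mu>1 \<delta>0 by auto
  then have quot0: "0 < ln (\<delta> / u) / ln (1 - \<mu>)" by (rule divide_neg_neg[rotated])
  then have N_int: "int N = \<lceil>ln (\<delta> / u) / ln (1 - \<mu>)\<rceil>" by (simp add: N_def)
  have "ln (\<delta> / u) / ln (1 - \<mu>) \<le> real N" unfolding N_def by linarith
  then have "real N * ln (1 - \<mu>) \<le> ln (\<delta> / u)" using ln_neg by (simp add: neg_divide_le_eq)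
  then have "ln ((1 - \<mu>) ^ N) \<le> ln (\<delta> / u)" using \<mu>1 by (simp add: ln_realpow)
  then have "(1 - \<mu>) ^ N \<le> \<delta> / u" using \<mu>1 \<delta>0 by (subst (asm) ln_le_cancel_iff) auto
  then have N: "(1 - \<mu>) ^ N * u \<le> \<delta>" using q_L_u by (simp add: field_simps)
  \<comment> \<open>Without an entry up to \<open>N\<close>, the strict decay at \<open>N\<close>
    would put \<open>z N \<omega>\<close> into the open target, even if
    \<open>(1 - \<mu>) ^ N * u\<close> equals \<delta>.\<close>
  have enters: "\<exists>n\<le>N. z n \<omega> \<in> ?S" if \<omega>: "\<omega> \<in> space M" for \<omega>
  proof (rule ccontr)
    assume out: "\<not> ?thesis"
    then have "\<bar>z N \<omega> - K\<bar> < (1 - \<mu>) ^ N * u" by (intro decay \<omega>) auto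
    with N have "z N \<omega> \<in> ?S" by (auto simp: abs_less_iff)
    with out show False by blast
  qed
  define \<tau> where "\<tau> = (\<lambda>\<omega>. LEAST n. z n \<omega> \<in> ?S)"
  have "\<tau> \<in> M \<rightarrow>\<^sub>M count_space UNIV"
    unfolding \<tau>_def
  proof (rule measurable_entry_time[where G = ?G])
    show "case_prod (?G n) \<in> borel_measurable (borel \<Otimes>\<^sub>M M)" for n
      by (rule measurable_dwc_step[OF f_cont noise_meas(2,1)])
    fix n \<omega> assume \<omega>: "\<omega> \<in> space M" and out: "\<forall>m\<le>n. z m \<omega> \<notin> ?S"
    have "\<bar>z n \<omega> - K\<bar> < (1 - \<mu>) ^ n * u" using out by (intro decay \<omega>) auto
    also have "\<dots> \<le> u" using \<mu>1 q_L_u by (simp add: mult_left_le_one_le power_le_one)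
    finally have "z n \<omega> \<in> {K - u <..< K + u}" by (auto simp: abs_less_iff)
    then show "z (Suc n) \<omega> = ?G n (z n \<omega>) \<omega>"
      by (rule step[OF \<omega>, THEN conjunct1]) (use out in auto)
  qed (use z0(1) enters in auto)
  moreover have "z (\<tau> \<omega>) \<omega> \<in> ?S \<and> int (\<tau> \<omega>) \<le> \<lceil>ln (\<delta> / u) / ln (1 - \<mu>)\<rceil>"
    if \<omega>: "\<omega> \<in> space M" for \<omega>
  proof -
    obtain n where n: "n \<le> N" "z n \<omega> \<in> ?S" using enters[OF \<omega>] by blast
    have "z (\<tau> \<omega>) \<omega> \<in> ?S" unfolding \<tau>_def by (rule LeastI, rule n(2))
    moreover have "\<tau> \<omega> \<le> n" unfolding \<tau>_def by (rule Least_le, rule n(2))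
    ultimately show ?thesis using n(1) N_int by linarith
  qed
  ultimately show ?thesis by blast
qed

end
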